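(* The class of co-Büchi tree languages does not have the first separation property. That is, there exist a finite alphabet $\Sigma$ and disjoint co-Büchi tree languages $L, M\subseteq T_\Sigma$ such that there is no $K\subseteq T_\Sigma$ with $L\subseteq K\subseteq T_\Sigma\setminus M$ for which both $K$ and $T_\Sigma\setminus K$ are co-Büchi.
   Context: For a finite alphabet $\Sigma$, a (full binary) tree over $\Sigma$ is a mapping $t:\{1,2\}^*\to\Sigma$, and $T_\Sigma$ is the set of all such trees. A non-deterministic parity tree automaton is $A=\langle\Sigma,Q,q_I,\mathrm{Tr},\mathrm{rank}\rangle$ with $Q$ a finite set of states, $q_I\in Q$ the initial state, $\mathrm{Tr}\subseteq Q\times\Sigma\times Q\times Q$ the set of transitions, and $\mathrm{rank}:Q\to\omega$. A run of $A$ on $t\in T_\Sigma$ is a mapping $\rho:\{1,2\}^*\to Q$ with $\rho(\varepsilon)=q_I$ and $(\rho(w),t(w),\rho(w1),\rho(w2))\in\mathrm{Tr}$ for every $w\in\{1,2\}^*$. A path $p_0p_1\ldots\in\{1,2\}^\omega$ in $\rho$ is accepting if $\limsup_{n\to\infty}\mathrm{rank}(\rho(p_0p_1\ldots p_n))$ is even; a run is accepting if all its paths are. The language recognized by $A$ is the set $T(A)$ of trees in $T_\Sigma$ that admit an accepting run. The Rabin–Mostowski index of $A$ is the pair $(\min(\mathrm{rank}(Q)),\max(\mathrm{rank}(Q)))$. A Büchi automaton is an automaton of index $(1,2)$ (so a run is accepting iff on each path some state of rank $2$ occurs infinitely often). A Büchi tree language is one recognized by a Büchi automaton; a co-Büchi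 tree language is the complement (in $T_\Sigma$) of a Büchi tree language. A class $\mathcal{L}$ of subsets of a universe $U$ has the first separation property if any two disjoint $L,M\in\mathcal{L}$ are separated by some $K$ (i.e. $L\subseteq K\subseteq U\setminus M$) such that both $K$ and $U\setminus K$ belong to $\mathcal{L}$. *)

theory Defs
  imports Main "HOL-Library.Extended_Nat" "HOL-Library.Liminf_Limsup"
begin

datatype dir = One | Two

type_synonym 'a tree = "dir list \<Rightarrow> 'a"

definition trees :: "'a set \<Rightarrow> 'a tree set" where
  "trees \<Sigma> = {t. range t \<subseteq> \<Sigma>}"

record ('a, 'q) automaton =
  alphabet :: "'a set"
  states :: "'q set"
  init :: 'q
  trans :: "('q \<times> 'a \<times> 'q \<times> 'q) set"
  rank :: "'q \<Rightarrow> nat"  \<comment> \<open>only the values on the states matter\<close>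

definition parity_automaton :: "('a, 'q) automaton \<Rightarrow> bool" where
  "parity_automaton A \<longleftrightarrow>
     finite (alphabet A) \<and> finite (states A) \<and> init A \<in> states A \<and>
     trans A \<subseteq> states A \<times> alphabet A \<times> states A \<times> states A"

definition is_run :: "('a, 'q) automaton \<Rightarrow> 'a tree \<Rightarrow> 'q tree \<Rightarrow> bool" where
  "is_run A t \<rho> \<longleftrightarrow>
     range \<rho> \<subseteq> states A \<and> \<rho> [] = init A \<and>
     (\<forall>w. (\<rho> w, t w, \<rho> (w @ [One]), \<rho> (w @ [Two])) \<in> trans A)"

text \<open>
  The limsup is taken in \<^typ>\<open>enat\<close>, which, unlike \<^typ>\<open>nat\<close>, is a complete lattice.
  On a run it is finite, because there are finitely many states.
\<close>
definition accepting_path :: "('a, 'q) automaton \<Rightarrow> 'q tree \<Rightarrow> (nat \<Rightarrow> dir) \<Rightarrow> bool" where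
  "accepting_path A \<rho> p \<longleftrightarrow>
     (\<exists>k. even k \<and> limsup (\<lambda>n. enat (rank A (\<rho> (map p [0..<Suc n])))) = enat k)"

definition accepting_run :: "('a, 'q) automaton \<Rightarrow> 'a tree \<Rightarrow> 'q tree \<Rightarrow> bool" where
  "accepting_run A t \<rho> \<longleftrightarrow> is_run A t \<rho> \<and> (\<forall>p. accepting_path A \<rho> p)"

definition language :: "('a, 'q) automaton \<Rightarrow> 'a tree set" where
  "language A = {t \<in> trees (alphabet A). \<exists>\<rho>. accepting_run A t \<rho>}"

definition index :: "('a, 'q) automaton \<Rightarrow> nat \<times> nat" where
  "index A = (Min (rank A ` states A), Max (rank A ` states A))"

definition buchi_automaton :: "('a, 'q) automaton \<Rightarrow> bool" where
  "buchi_automaton A \<longleftrightarrow> parity_automaton A \<and> index A = (1, 2)"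

text \<open>
  States are drawn from \<^typ>\<open>nat\<close>, since the state type cannot be quantified inside a
  definition. As state sets are finite, nothing is lost: see \<open>buchi_language_any_states\<close>.
\<close>
definition buchi_language :: "'a set \<Rightarrow> 'a tree set \<Rightarrow> bool" where
  "buchi_language \<Sigma> L \<longleftrightarrow>
     (\<exists>A :: ('a, nat) automaton. buchi_automaton A \<and> alphabet A = \<Sigma> \<and> language A = L)"

definition co_buchi_language :: "'a set \<Rightarrow> 'a tree set \<Rightarrow> bool" where
  "co_buchi_language \<Sigma> L \<longleftrightarrow> (\<exists>B. buchi_language \<Sigma> B \<and> L = trees \<Sigma> - B)"

definition first_separation_property :: "'u set \<Rightarrow> 'u set set \<Rightarrow> bool" where
  "first_separation_property U \<L> \<longleftrightarrow>
     (\<forall>L\<in>\<L>. \<forall>M\<in>\<L>. L \<inter> M = {} \<longrightarrow>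
        (\<exists>K. L \<subseteq> K \<and> K \<subseteq> U - M \<and> K \<in> \<L> \<and> U - K \<in> \<L>))"

lemma buchi_language_any_states:
  fixes A :: "('a, 'q) automaton"
  assumes "buchi_automaton A"
  shows "buchi_language (alphabet A) (language A)"
proof -
  have fin: "finite (states A)" and init: "init A \<in> states A"
    and tr: "trans A \<subseteq> states A \<times> alphabet A \<times> states A \<times> states A"
    using assms by (auto simp: buchi_automaton_def parity_automaton_def)
  obtain f :: "'q \<Rightarrow> nat" where f: "inj_on f (states A)"
    using finite_imp_inj_to_nat_seg[OF fin] by blast
  define g where "g = inv_into (states A) f"
  have gf: "g (f q) = q" if "q \<in> states A" for q
    using that f by (simp add: g_def)
  define B where "B = \<lparr>alphabet = alphabet A, states = f ` states A, init = f (init A),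
    trans = (\<lambda>(q, a, q1, q2). (f q, a, f q1, f q2)) ` trans A, rank = rank A \<circ> g\<rparr>"
  have rk: "rank B ` states B = rank A ` states A"
    by (auto simp: B_def gf image_image)
  have B: "buchi_automaton B"
    using assms tr unfolding buchi_automaton_def parity_automaton_def index_def rk
    by (auto simp: B_def)
  have "accepting_run B t (f \<circ> \<rho>)" if "accepting_run A t \<rho>" for t \<rho>
  proof -
    have r: "range \<rho> \<subseteq> states A" using that by (auto simp: accepting_run_def is_run_def)
    have g\<rho>: "g (f (\<rho> w)) = \<rho> w" for w
      using r by (intro gf) auto
    have "(f (\<rho> w), t w, f (\<rho> (w @ [One])), f (\<rho> (w @ [Two]))) \<in> trans B" for w
    proof -
      have "(\<rho> w, t w, \<rho> (w @ [One]), \<rho> (w @ [Two])) \<in> trans A"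
        using that by (simp add: accepting_run_def is_run_def)
      then show ?thesis by (auto simp: B_def intro: rev_image_eqI)
    qed
    moreover have "range (f \<circ> \<rho>) \<subseteq> states B" using r by (auto simp: B_def)
    moreover have "(f \<circ> \<rho>) [] = init B"
      using that by (simp add: accepting_run_def is_run_def B_def)
    moreover have "accepting_path B (f \<circ> \<rho>) p" for p
      using that by (simp add: accepting_run_def accepting_path_def B_def g\<rho>)
    ultimately show ?thesis by (simp add: accepting_run_def is_run_def)
  qed
  moreover have "accepting_run A t (g \<circ> \<rho>)" if "accepting_run B t \<rho>" for t \<rho>
  proof -
    have r: "range \<rho> \<subseteq> f ` states A" "\<rho> [] = f (init A)"
      using that by (auto simp: accepting_run_def is_run_def B_def)
    have "(g (\<rho> w), t w, g (\<rho> (w @ [One])), g (\<rho> (w @ [Two]))) \<in> trans A" for w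
    proof -
      have "(\<rho> w, t w, \<rho> (w @ [One]), \<rho> (w @ [Two])) \<in> trans B"
        using that by (auto simp: accepting_run_def is_run_def)
      then obtain q a q1 q2 where "(q, a, q1, q2) \<in> trans A"
        "\<rho> w = f q" "t w = a" "\<rho> (w @ [One]) = f q1" "\<rho> (w @ [Two]) = f q2"
        by (auto simp: B_def)
      then show ?thesis using tr by (auto simp: gf subset_iff)
    qed
    moreover have "range (g \<circ> \<rho>) \<subseteq> states A"
      using r(1) gf by fastforce
    moreover have "accepting_path A (g \<circ> \<rho>) p" for p
      using that by (auto simp: accepting_run_def accepting_path_def B_def)
    ultimately show ?thesis
      using r(2) gf[OF init] by (simp add: accepting_run_def is_run_def)
  qed
  ultimately have "(\<exists>\<rho>. accepting_run B t \<rho>) \<longleftrightarrow> (\<exists>\<rho>. accepting_run A t \<rho>)" for t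
    by blast
  then have "language B = language A"
    by (simp add: language_def B_def)
  moreover have "alphabet B = alphabet A" by (simp add: B_def)
  ultimately show ?thesis
    using B unfolding buchi_language_def by blast
qed

end

theory Submission
  imports Defs
begin

text \<open>
  A tree over \<open>{0, 1, 2, 3}\<close> is read as a game between players \<open>0\<close> and \<open>1\<close>, who descend from the
  root together: a node labelled \<open>a\<close> belongs to player \<open>a mod 2\<close> and has colour \<open>a div 2\<close>. Let \<open>W\<^sub>i\<close>
  be the set of the trees in which player \<open>i\<close> can force colour \<open>i\<close> to occur infinitely often (\<open>wins\<close>). A
  nondeterministic automaton can guess the strategy, so \<open>W\<^sub>i\<close> is a Buchi language
  (\<open>buchi_language_wins\<close>). The inseparable pair consists of the complements of \<open>W\<^sub>0\<close> and \<open>W\<^sub>1\<close>. They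
  are disjoint because \<open>W\<^sub>0 \<union> W\<^sub>1\<close> is everything (\<open>someone_wins\<close>): if player \<open>0\<close> cannot force colour \<open>0\<close>
  infinitely often, then by determinacy player \<open>1\<close> can ensure that only colour \<open>1\<close> occurs from some
  moment on, and in particular that it occurs infinitely often (\<open>forces_or_forces\<close>).

  Suppose that \<open>K\<close> separates the two complements, with Buchi automata \<open>A\<^sub>0\<close> for \<open>K\<close> and \<open>A\<^sub>1\<close> for the
  complement of \<open>K\<close>. Then \<open>K \<subseteq> W\<^sub>1\<close>, and the complement of \<open>K\<close> is contained in \<open>W\<^sub>0\<close>. This is refuted by
  a diagonal argument. From a tree \<open>t\<close> one builds a tree \<open>H t\<close> in which the players
  run both automata on \<open>t\<close> simultaneously, along two independent branches: player \<open>i\<close> chooses the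
  transitions of \<open>A\<^sub>i\<close>, and the opponent chooses the branch on which \<open>A\<^sub>i\<close> runs. The colour of a node
  is the index of the automaton that was the last to visit a state of rank \<open>2\<close>.

  If \<open>A\<^sub>x\<close> accepts \<open>t\<close> and \<open>A\<^sub>y\<close> is the other automaton, then player \<open>x\<close> can follow an accepting run
  and so makes \<open>A\<^sub>x\<close> visit rank \<open>2\<close> infinitely often. If player \<open>y\<close> could still force colour \<open>y\<close>
  infinitely often, then \<open>A\<^sub>y\<close> would visit rank \<open>2\<close> infinitely often on every branch that player \<open>x\<close>
  chooses, and the winning strategy would describe an accepting run of \<open>A\<^sub>y\<close> on \<open>t\<close>
  (\<open>accepting_run_if_wins_duel\<close>). The two languages being disjoint, \<open>t \<in> T(A\<^sub>x)\<close> implies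
  \<open>H t \<notin> W\<^sub>y\<close>.

  The label of \<open>H t\<close> at a node depends only on the labels of \<open>t\<close> at smaller depths, so
  there is a tree with \<open>H t = t\<close> (\<open>ex_game_tree_fixpoint\<close>). It lies in one of the two languages, say in
  \<open>T(A\<^sub>x)\<close>, which is contained in \<open>W\<^sub>y\<close>; but \<open>t = H t \<notin> W\<^sub>y\<close>.
\<close>

section \<open>Plays on the binary tree\<close>

abbreviation infinitely_often :: "(nat \<Rightarrow> bool) \<Rightarrow> bool" where
  "infinitely_often P \<equiv> \<forall>n. \<exists>m\<ge>n. P m"

definition pre :: "(nat \<Rightarrow> dir) \<Rightarrow> nat \<Rightarrow> dir list" where
  "pre p n = map p [0..<n]"

lemma length_pre [simp]: "length (pre p n) = n"
  by (simp add: pre_def)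

lemma pre_0 [simp]: "pre p 0 = []"
  by (simp add: pre_def)

lemma pre_Suc: "pre p (Suc n) = pre p n @ [p n]"
  by (simp add: pre_def)

lemma take_pre [simp]: "take m (pre p n) = pre p (min m n)"
  by (simp add: pre_def take_map min_def)

lemma pre_cong: "(\<And>i. i < n \<Longrightarrow> p i = q i) \<Longrightarrow> pre p n = pre q n"
  by (simp add: pre_def)

text \<open>The values beyond the finite path are arbitrary: only those on the path ever matter.\<close>

definition extend_path :: "dir list \<Rightarrow> nat \<Rightarrow> dir" where
  "extend_path w n = (if n < length w then w ! n else One)"

lemma pre_extend_path [simp]: "pre (extend_path w) (length w) = w"
  by (rule nth_equalityI) (simp_all add: pre_def extend_path_def)

lemma extend_path_pre: "i < n \<Longrightarrow> extend_path (pre p n) i = p i"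
  by (simp add: extend_path_def pre_def)

lemma ex_play_following: "\<exists>p. \<forall>n. p n = F (pre p n)"
proof -
  define v where "v n = rec_nat [] (\<lambda>_ w. w @ [F w]) n" for n
  define p where "p n = F (v n)" for n
  have "pre p n = v n" for n
    by (induction n) (simp_all add: pre_Suc v_def p_def)
  then have "p n = F (pre p n)" for n
    by (simp add: p_def)
  then show ?thesis by blast
qed

lemma all_dir: "(\<forall>d. P d) \<longleftrightarrow> P One \<and> P Two"
  by (metis dir.exhaust)

section \<open>Acceptance by Buchi automata\<close>

lemma limsup_enat_1_2:
  fixes f :: "nat \<Rightarrow> nat"
  assumes "\<And>n. f n = 1 \<or> f n = 2"
  shows "limsup (\<lambda>n. enat (f n)) = (if infinitely_often (\<lambda>n. f n = 2) then 2 else 1)"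
proof -
  have le2: "enat (f m) \<le> 2" and ge1: "1 \<le> enat (f m)" for m
    using assms[of m] by (auto simp: one_enat_def numeral_eq_enat)
  show ?thesis
  proof (cases "infinitely_often (\<lambda>n. f n = 2)")
    case True
    have "(SUP m\<in>{n..}. enat (f m)) = 2" for n
    proof (rule antisym)
      show "(SUP m\<in>{n..}. enat (f m)) \<le> 2" by (intro SUP_least le2)
      obtain m where "m \<ge> n" "f m = 2" using True by blast
      then show "2 \<le> (SUP m\<in>{n..}. enat (f m))"
        by (intro SUP_upper2[of m]) (auto simp: numeral_eq_enat)
    qed
    then show ?thesis using True by (simp add: limsup_INF_SUP)
  next
    case False
    then obtain N where N: "\<And>m. m \<ge> N \<Longrightarrow> f m = 1"
      using assms by blast
    have "limsup (\<lambda>n. enat (f n)) = 1"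
      unfolding limsup_INF_SUP
    proof (intro antisym INF_greatest)
      have "(SUP m\<in>{N..}. enat (f m)) \<le> 1"
        by (intro SUP_least) (simp add: N one_enat_def)
      then show "(INF n. SUP m\<in>{n..}. enat (f m)) \<le> 1"
        by (rule INF_lower2[OF UNIV_I])
      show "1 \<le> (SUP m\<in>{n..}. enat (f m))" for n
        by (rule SUP_upper2[of n]) (simp_all add: ge1)
    qed
    then show ?thesis using False by simp
  qed
qed

lemma accepting_path_buchi:
  assumes "buchi_automaton A" "range \<rho> \<subseteq> states A"
  shows "accepting_path A \<rho> p \<longleftrightarrow> infinitely_often (\<lambda>n. rank A (\<rho> (pre p n)) = 2)"
proof -
  let ?f = "\<lambda>n. rank A (\<rho> (pre p (Suc n)))"
  have fin: "finite (rank A ` states A)" and ix: "Min (rank A ` states A) = 1" "Max (rank A ` states A) = 2"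
    using assms(1) by (auto simp: buchi_automaton_def parity_automaton_def index_def)
  have "?f n = 1 \<or> ?f n = 2" for n
  proof -
    have "?f n \<in> rank A ` states A" using assms(2) by auto
    then have "1 \<le> ?f n" "?f n \<le> 2"
      using Min_le[OF fin] Max_ge[OF fin] ix by metis+
    then show ?thesis by linarith
  qed
  from limsup_enat_1_2[of ?f, OF this]
  have "accepting_path A \<rho> p \<longleftrightarrow> infinitely_often (\<lambda>n. ?f n = 2)"
    by (auto simp: accepting_path_def pre_def one_enat_def numeral_eq_enat)
  also have "\<dots> \<longleftrightarrow> infinitely_often (\<lambda>n. rank A (\<rho> (pre p n)) = 2)"
    by (metis Suc_le_D Suc_le_mono le_SucI)
  finally show ?thesis .
qed

section \<open>Determinacy\<close>

definition forces :: "dir list set \<Rightarrow> dir list set \<Rightarrow> dir list \<Rightarrow> bool" where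
  "forces V C w \<longleftrightarrow> (\<exists>\<sigma>. \<forall>p. pre p (length w) = w \<longrightarrow>
     (\<forall>n\<ge>length w. pre p n \<in> V \<longrightarrow> p n = \<sigma> (pre p n)) \<longrightarrow>
     infinitely_often (\<lambda>n. pre p n \<in> C))"

text \<open>
  Winning strategies from different nodes can be glued: follow \<open>\<sigma>\<close>, and at the first node
  that is winning switch for good to a winning strategy from there. Strategies
  see the whole history, so the place of the switch can be read off the current node.
\<close>

lemma forces_if_reaches:
  assumes "\<And>p. pre p (length w) = w \<Longrightarrow>
    (\<forall>n\<ge>length w. pre p n \<in> V \<longrightarrow> p n = \<sigma> (pre p n)) \<Longrightarrow>
    (\<forall>n\<ge>length w. \<not> forces V C (pre p n)) \<Longrightarrow> infinitely_often (\<lambda>n. pre p n \<in> C)"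
  shows "forces V C w"
proof -
  let ?W = "forces V C"
  have "\<forall>v. \<exists>\<tau>. ?W v \<longrightarrow> (\<forall>p. pre p (length v) = v \<longrightarrow>
      (\<forall>n\<ge>length v. pre p n \<in> V \<longrightarrow> p n = \<tau> (pre p n)) \<longrightarrow> infinitely_often (\<lambda>n. pre p n \<in> C))"
    unfolding forces_def by blast
  then obtain S where S: "\<And>v p. ?W v \<Longrightarrow> pre p (length v) = v \<Longrightarrow>
      (\<forall>n\<ge>length v. pre p n \<in> V \<longrightarrow> p n = S v (pre p n)) \<Longrightarrow> infinitely_often (\<lambda>n. pre p n \<in> C)"
    by metis
  \<comment> \<open>the strategy that switches at the shortest prefix of the history that is already winning\<close>
  define \<tau> where "\<tau> v = (let Q = (\<lambda>m. length w \<le> m \<and> m \<le> length v \<and> ?W (take m v)) in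
      if Ex Q then S (take (Least Q) v) v else \<sigma> v)" for v
  have "infinitely_often (\<lambda>n. pre p n \<in> C)"
    if w: "pre p (length w) = w" and follows: "\<forall>n\<ge>length w. pre p n \<in> V \<longrightarrow> p n = \<tau> (pre p n)" for p
  proof (cases "\<exists>m\<ge>length w. ?W (pre p m)")
    case False
    then have "\<tau> (pre p n) = \<sigma> (pre p n)" if "n \<ge> length w" for n
      using that by (auto simp: \<tau>_def Let_def min_def)
    with follows False show ?thesis by (intro assms w) auto
  next
    case True
    define m where "m = (LEAST m. length w \<le> m \<and> ?W (pre p m))"
    have m: "length w \<le> m" "?W (pre p m)"
      using LeastI_ex[of "\<lambda>m. length w \<le> m \<and> ?W (pre p m)"] True by (auto simp: m_def)
    have "\<tau> (pre p n) = S (pre p m) (pre p n)" if "n \<ge> m" for n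
    proof -
      let ?Q = "\<lambda>m. length w \<le> m \<and> m \<le> length (pre p n) \<and> ?W (take m (pre p n))"
      have "?Q m" using m that by simp
      moreover have "Least ?Q = m"
        by (rule Least_equality) (use \<open>?Q m\<close> in \<open>auto simp: m_def min_def intro: Least_le\<close>)
      ultimately show ?thesis
        using that unfolding \<tau>_def Let_def by (auto simp: min_def)
    qed
    with follows m show ?thesis by (intro S[OF m(2)]) auto
  qed
  then show ?thesis unfolding forces_def by blast
qed

text \<open>
  The owner of \<open>V\<close> can force the play from \<open>attractor V G n\<close> into \<open>G\<close> within \<open>n\<close> moves. As the tree
  is finitely branching, the number of moves is bounded even where the opponent chooses among them,
  so natural numbers are enough for the ranks.
\<close>

fun attractor :: "dir list set \<Rightarrow> dir list set \<Rightarrow> nat \<Rightarrow> dir list set" where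
  "attractor V G 0 = G"
| "attractor V G (Suc n) = attractor V G n \<union>
     {w. if w \<in> V then \<exists>d. w @ [d] \<in> attractor V G n else \<forall>d. w @ [d] \<in> attractor V G n}"

lemma attractor_mono: "m \<le> n \<Longrightarrow> attractor V G m \<subseteq> attractor V G n"
  by (rule lift_Suc_mono_le[of "attractor V G"]) auto

text \<open>
  Suppose that the root is not winning for the owner of \<open>V\<close>, and let \<open>G\<close> be the set of the nodes that
  lie outside \<open>C\<close> and are not winning for that player. From every node that is not winning the
  opponent can force a visit to \<open>G\<close>: otherwise the owner of \<open>V\<close> could avoid \<open>G\<close>, which means staying in
  \<open>C\<close> until, possibly, a winning node is reached, and so would win after all. From \<open>G\<close> the opponent
  can move to a node that again is not winning, and start over.
\<close>

lemma forces_or_forces: "forces (- V) (- C) [] \<or> forces V C []"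
proof (rule disjCI)
  assume root: "\<not> forces V C []"
  let ?W = "forces V C"
  define G where "G = {w. w \<notin> C \<and> \<not> ?W w}"
  define Att where "Att = (\<Union>n. attractor (- V) G n)"
  have escape_V: "\<exists>d. v @ [d] \<notin> Att" if "v \<in> V" "v \<notin> Att" for v
  proof (rule ccontr)
    assume "\<not> (\<exists>d. v @ [d] \<notin> Att)"
    then have "v @ [One] \<in> Att" "v @ [Two] \<in> Att" by blast+
    then obtain a b where "v @ [One] \<in> attractor (- V) G a" "v @ [Two] \<in> attractor (- V) G b"
      unfolding Att_def by blast
    then have "\<forall>d. v @ [d] \<in> attractor (- V) G (max a b)"
      using attractor_mono[of a "max a b" "- V" G] attractor_mono[of b "max a b" "- V" G]
      by (auto simp: all_dir)
    then have "v \<in> attractor (- V) G (Suc (max a b))"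
      using \<open>v \<in> V\<close> by simp
    then show False using \<open>v \<notin> Att\<close> unfolding Att_def by blast
  qed
  have escape_not_V: "v @ [d] \<notin> Att" if "v \<notin> V" "v \<notin> Att" for v d
  proof
    assume "v @ [d] \<in> Att"
    then obtain a where "v @ [d] \<in> attractor (- V) G a" by (auto simp: Att_def)
    then have "v \<in> attractor (- V) G (Suc a)" using \<open>v \<notin> V\<close> by auto
    then show False using \<open>v \<notin> Att\<close> unfolding Att_def by blast
  qed
  \<comment> \<open>the opponent can force a visit to \<open>G\<close> from every node that is not winning\<close>
  have in_Att: "w \<in> Att" if "\<not> ?W w" for w
  proof (rule ccontr)
    assume "w \<notin> Att"
    have "?W w"
    proof (rule forces_if_reaches[where \<sigma> = "\<lambda>v. SOME d. v @ [d] \<notin> Att"])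
      fix p
      assume w: "pre p (length w) = w"
        and follows: "\<forall>n\<ge>length w. pre p n \<in> V \<longrightarrow> p n = (SOME d. pre p n @ [d] \<notin> Att)"
        and never: "\<forall>n\<ge>length w. \<not> ?W (pre p n)"
      have "pre p n \<notin> Att" if "n \<ge> length w" for n
        using that
      proof (induction n rule: dec_induct)
        case base
        then show ?case using w \<open>w \<notin> Att\<close> by simp
      next
        case (step n)
        then show ?case
          using follows escape_not_V someI_ex[OF escape_V[of "pre p n"]]
          by (cases "pre p n \<in> V") (auto simp: pre_Suc)
      qed
      then have "pre p n \<notin> G" if "n \<ge> length w" for n
        using that unfolding Att_def by (metis UN_I UNIV_I attractor.simps(1))
      then show "infinitely_often (\<lambda>n. pre p n \<in> C)"
        using never unfolding G_def by (metis (mono_tags, lifting) mem_Collect_eq nle_le)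
    qed
    with that show False by simp
  qed
  \<comment> \<open>the opponent can stay among the nodes that are not winning\<close>
  have stay_V: "\<not> ?W (w @ [d])" if "\<not> ?W w" "w \<in> V" for w d
  proof
    assume "?W (w @ [d])"
    have "?W w"
    proof (rule forces_if_reaches[where \<sigma> = "\<lambda>_. d"])
      fix p
      assume w: "pre p (length w) = w" and "\<forall>n\<ge>length w. pre p n \<in> V \<longrightarrow> p n = d"
        and never: "\<forall>n\<ge>length w. \<not> ?W (pre p n)"
      then have "p (length w) = d" using \<open>w \<in> V\<close> by auto
      with w have "pre p (Suc (length w)) = w @ [d]" by (simp add: pre_Suc)
      moreover have "\<not> ?W (pre p (Suc (length w)))" using never by (meson le_SucI order_refl)
      ultimately show "infinitely_often (\<lambda>n. pre p n \<in> C)"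
        using \<open>?W (w @ [d])\<close> by simp
    qed
    with that show False by simp
  qed
  have stay_not_V: "\<exists>d. \<not> ?W (w @ [d])" if "\<not> ?W w" for w
  proof (rule ccontr)
    assume *: "\<not> (\<exists>d. \<not> ?W (w @ [d]))"
    have "?W w"
    proof (rule forces_if_reaches)
      fix p
      assume "pre p (length w) = w" and never: "\<forall>n\<ge>length w. \<not> ?W (pre p n)"
      then have "pre p (Suc (length w)) = w @ [p (length w)]" "\<not> ?W (pre p (Suc (length w)))"
        by (simp add: pre_Suc) (use never in \<open>meson le_SucI order_refl\<close>)
      then show "infinitely_often (\<lambda>n. pre p n \<in> C)"
        using * by simp
    qed
    with that show False by simp
  qed
  define rk where "rk w = (LEAST n. w \<in> attractor (- V) G n)" for w
  \<comment> \<open>descend in attractor rank until \<open>G\<close> is reached, then step to a node that is not winning for \<open>V\<close>\<close>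
  define \<tau> where "\<tau> v = (if v \<in> G then SOME d. \<not> ?W (v @ [d])
      else SOME d. v @ [d] \<in> attractor (- V) G (rk v - 1))" for v
  have "infinitely_often (\<lambda>n. pre p n \<in> - C)"
    if follows: "\<And>n. pre p n \<notin> V \<Longrightarrow> p n = \<tau> (pre p n)" for p
  proof -
    have from_G: "\<not> ?W (pre p (Suc n))" if "pre p n \<in> G" for n
      using that follows[of n] stay_V someI_ex[OF stay_not_V[of "pre p n"]]
      by (cases "pre p n \<in> V") (auto simp: pre_Suc \<tau>_def G_def)
    have descend: "pre p (Suc n) \<in> attractor (- V) G (rk (pre p n) - 1) \<and> 0 < rk (pre p n)"
      if in_Att': "pre p n \<in> Att" and not_G: "pre p n \<notin> G" for n
    proof -
      let ?v = "pre p n"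
      have v: "?v \<in> attractor (- V) G (rk ?v)"
        using in_Att' LeastI_ex[of "\<lambda>n. ?v \<in> attractor (- V) G n"] by (auto simp: Att_def rk_def)
      then obtain m where m: "rk ?v = Suc m"
        using not_G by (cases "rk ?v") auto
      then have "?v \<notin> attractor (- V) G m"
        using not_less_Least[of m "\<lambda>n. ?v \<in> attractor (- V) G n"] by (simp add: rk_def)
      with v m have *: "if ?v \<notin> V then \<exists>d. ?v @ [d] \<in> attractor (- V) G m
          else \<forall>d. ?v @ [d] \<in> attractor (- V) G m"
        by (auto split: if_splits)
      show ?thesis
      proof (cases "?v \<in> V")
        case True
        with * m show ?thesis by (simp add: pre_Suc)
      next
        case False
        then have "?v @ [\<tau> ?v] \<in> attractor (- V) G m"
          using * not_G m someI_ex[of "\<lambda>d. ?v @ [d] \<in> attractor (- V) G m"]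
          by (simp add: \<tau>_def)
        with False m show ?thesis using follows[of n] by (simp add: pre_Suc)
      qed
    qed
    have all_Att: "pre p n \<in> Att" for n
    proof (induction n)
      case 0
      then show ?case using root in_Att by simp
    next
      case (Suc n)
      show ?case
      proof (cases "pre p n \<in> G")
        case True
        then show ?thesis by (intro in_Att from_G)
      next
        case False
        then show ?thesis using descend[OF Suc] unfolding Att_def by blast
      qed
    qed
    have "\<exists>m\<ge>n. pre p m \<in> G" for n
    proof (induction "rk (pre p n)" arbitrary: n rule: less_induct)
      case less
      show ?case
      proof (cases "pre p n \<in> G")
        case False
        with descend all_Att have d: "pre p (Suc n) \<in> attractor (- V) G (rk (pre p n) - 1)"
          "0 < rk (pre p n)" by blast+
        then have "rk (pre p (Suc n)) \<le> rk (pre p n) - 1"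
          unfolding rk_def[of "pre p (Suc n)"] by (intro Least_le)
        with d(2) less[of "Suc n"] show ?thesis by (meson Suc_leD diff_less le_less_trans zero_less_one)
      qed auto
    qed
    then show ?thesis by (auto simp: G_def)
  qed
  then show "forces (- V) (- C) []"
    unfolding forces_def by (intro exI[of _ \<tau>]) auto
qed

section \<open>The game languages\<close>

definition wins :: "nat \<Rightarrow> nat tree \<Rightarrow> bool" where
  "wins i t \<longleftrightarrow> forces {w. t w mod 2 = i} {w. t w div 2 = i} []"

lemma someone_wins:
  assumes "t \<in> trees {..<4}"
  shows "wins 0 t \<or> wins 1 t"
proof -
  have "t w mod 2 = 1 \<longleftrightarrow> t w mod 2 \<noteq> 0" "t w div 2 = 1 \<longleftrightarrow> t w div 2 \<noteq> 0" for w
  proof -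
    have "t w < 4" using assms by (auto simp: trees_def)
    then show "t w mod 2 = 1 \<longleftrightarrow> t w mod 2 \<noteq> 0" "t w div 2 = 1 \<longleftrightarrow> t w div 2 \<noteq> 0"
      by linarith+
  qed
  then have "{w. t w mod 2 = 1} = - {w. t w mod 2 = 0}" "{w. t w div 2 = 1} = - {w. t w div 2 = 0}"
    by auto
  then show ?thesis
    unfolding wins_def using forces_or_forces[of "{w. t w mod 2 = 0}" "{w. t w div 2 = 0}"] by auto
qed

text \<open>
  The automaton guesses a strategy of player \<open>i\<close>. State \<open>0\<close> marks the nodes that the strategy
  avoids; it has rank \<open>2\<close> because branches off the strategy must not matter. On the branches that
  follow the strategy, \<open>mark\<close> is \<open>2\<close> or \<open>1\<close> according to whether the parent has colour \<open>i\<close>.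
\<close>

definition mark :: "nat \<Rightarrow> nat \<Rightarrow> nat" where
  "mark i a = (if a div 2 = i then 2 else 1)"

definition moves :: "nat \<Rightarrow> nat \<Rightarrow> nat \<Rightarrow> (nat \<times> nat) set" where
  "moves i q a = (if q = 0 then {(0, 0)}
     else if a mod 2 = i then {(mark i a, 0), (0, mark i a)} else {(mark i a, mark i a)})"

definition strategy_automaton :: "nat \<Rightarrow> (nat, nat) automaton" where
  "strategy_automaton i = \<lparr>alphabet = {..<4}, states = {0, 1, 2}, init = 1,
     trans = {(q, a, s). q \<in> {0, 1, 2} \<and> a < 4 \<and> s \<in> moves i q a},
     rank = (\<lambda>q. if q = 1 then 1 else 2)\<rparr>"

lemma strategy_automaton_simps [simp]:
  "alphabet (strategy_automaton i) = {..<4}"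
  "states (strategy_automaton i) = {0, 1, 2}"
  "init (strategy_automaton i) = 1"
  "(q, a, s) \<in> trans (strategy_automaton i) \<longleftrightarrow> q \<in> {0, 1, 2} \<and> a < 4 \<and> s \<in> moves i q a"
  "rank (strategy_automaton i) q = (if q = 1 then 1 else 2)"
  by (simp_all add: strategy_automaton_def)

lemma mark_pos [simp]: "0 < mark i a" "mark i a \<noteq> 0"
  by (simp_all add: mark_def)

lemma buchi_strategy_automaton: "buchi_automaton (strategy_automaton i)"
proof -
  have "rank (strategy_automaton i) ` states (strategy_automaton i) = {1, 2}"
    by auto
  then have "index (strategy_automaton i) = (1, 2)"
    by (simp add: index_def)
  moreover have "moves i q a \<subseteq> {0, 1, 2} \<times> {0, 1, 2}" for q a
    by (simp add: moves_def mark_def)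
  then have "trans (strategy_automaton i) \<subseteq> {0, 1, 2} \<times> {..<4} \<times> {0, 1, 2} \<times> {0, 1, 2}"
    unfolding strategy_automaton_def by fastforce
  then have "parity_automaton (strategy_automaton i)"
    by (simp add: parity_automaton_def)
  ultimately show ?thesis by (simp add: buchi_automaton_def)
qed

lemma wins_if_accepting_run:
  assumes "accepting_run (strategy_automaton i) t \<rho>"
  shows "wins i t"
proof -
  have run: "is_run (strategy_automaton i) t \<rho>" and
    acc: "\<And>p. accepting_path (strategy_automaton i) \<rho> p"
    using assms by (auto simp: accepting_run_def)
  have T: "(\<rho> (w @ [One]), \<rho> (w @ [Two])) \<in> moves i (\<rho> w) (t w)" for w
    using run by (simp add: is_run_def)
  define \<sigma> where "\<sigma> w = (if \<rho> (w @ [One]) \<noteq> 0 then One else Two)" for w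
  have "infinitely_often (\<lambda>n. t (pre p n) div 2 = i)"
    if follows: "\<And>n. t (pre p n) mod 2 = i \<Longrightarrow> p n = \<sigma> (pre p n)" for p
  proof
    fix n
    have step: "\<rho> (pre p (Suc n)) = mark i (t (pre p n))" if "\<rho> (pre p n) \<noteq> 0" for n
      using that T[of "pre p n"] follows[of n]
      by (cases "p n") (auto simp: pre_Suc \<sigma>_def moves_def split: if_splits)
    have nonzero: "\<rho> (pre p n) \<noteq> 0" for n
    proof (induction n)
      case 0
      then show ?case using run by (simp add: is_run_def)
    next
      case (Suc n)
      then show ?case using step by simp
    qed
    have "infinitely_often (\<lambda>n. rank (strategy_automaton i) (\<rho> (pre p n)) = 2)"
      using acc accepting_path_buchi[OF buchi_strategy_automaton] run unfolding is_run_def by blast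
    then obtain m where "m \<ge> Suc n" "\<rho> (pre p m) \<noteq> 1"
      using nonzero by (fastforce split: if_splits)
    then obtain l where "l \<ge> n" "\<rho> (pre p (Suc l)) \<noteq> 1"
      by (metis Suc_le_D Suc_le_mono)
    then have "t (pre p l) div 2 = i"
      using step nonzero by (auto simp: mark_def split: if_splits)
    then show "\<exists>m\<ge>n. t (pre p m) div 2 = i" using \<open>l \<ge> n\<close> by blast
  qed
  then show ?thesis
    unfolding wins_def forces_def by (intro exI[of _ \<sigma>]) auto
qed

lemma accepting_run_if_wins:
  assumes "t \<in> trees {..<4}" "wins i t"
  shows "\<exists>\<rho>. accepting_run (strategy_automaton i) t \<rho>"
proof -
  obtain \<sigma> where \<sigma>: "\<And>p. (\<forall>n. t (pre p n) mod 2 = i \<longrightarrow> p n = \<sigma> (pre p n)) \<Longrightarrow>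
      infinitely_often (\<lambda>n. t (pre p n) div 2 = i)"
    using assms(2) unfolding wins_def forces_def by auto
  define on where "on w \<longleftrightarrow> (\<forall>n<length w. t (take n w) mod 2 = i \<longrightarrow> w ! n = \<sigma> (take n w))" for w
  have on_Nil: "on []" by (simp add: on_def)
  have on_snoc: "on (w @ [d]) \<longleftrightarrow> on w \<and> (t w mod 2 = i \<longrightarrow> d = \<sigma> w)" for w d
    by (auto simp: on_def less_Suc_eq nth_append)
  define \<rho> where "\<rho> w = (if on w then if w = [] then 1 else mark i (t (butlast w)) else 0)" for w
  have lab: "t w < 4" for w using assms(1) by (auto simp: trees_def)
  have "range \<rho> \<subseteq> states (strategy_automaton i)"
    by (auto simp: \<rho>_def mark_def)
  moreover have "\<rho> [] = init (strategy_automaton i)"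
    using on_Nil by (simp add: \<rho>_def)
  moreover have "(\<rho> w, t w, \<rho> (w @ [One]), \<rho> (w @ [Two])) \<in> trans (strategy_automaton i)" for w
  proof -
    have "\<rho> w \<in> {0, 1, 2}" by (simp add: \<rho>_def mark_def)
    moreover have "(\<rho> (w @ [One]), \<rho> (w @ [Two])) \<in> moves i (\<rho> w) (t w)"
      by (cases "\<sigma> w") (auto simp: \<rho>_def on_snoc moves_def)
    ultimately show ?thesis using lab[of w] by simp
  qed
  ultimately have run: "is_run (strategy_automaton i) t \<rho>"
    by (simp add: is_run_def)
  have "infinitely_often (\<lambda>n. rank (strategy_automaton i) (\<rho> (pre p n)) = 2)" for p
  proof (cases "\<forall>n. on (pre p n)")
    case True
    have "p n = \<sigma> (pre p n)" if "t (pre p n) mod 2 = i" for n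
      using True[rule_format, of "Suc n"] that by (simp add: pre_Suc on_snoc)
    then have inf: "infinitely_often (\<lambda>n. t (pre p n) div 2 = i)"
      using \<sigma> by blast
    have "rank (strategy_automaton i) (\<rho> (pre p (Suc m))) = 2" if "t (pre p m) div 2 = i" for m
      using True[rule_format, of "Suc m"] that by (simp add: \<rho>_def pre_Suc mark_def)
    then show ?thesis
      using inf by (meson le_SucI)
  next
    case False
    then obtain n0 where n0: "\<not> on (pre p n0)" by blast
    have "\<not> on (pre p n)" if "n \<ge> n0" for n
      using that by (induction n rule: dec_induct) (auto simp: n0 pre_Suc on_snoc)
    then have "rank (strategy_automaton i) (\<rho> (pre p n)) = 2" if "n \<ge> n0" for n
      using that by (simp add: \<rho>_def)
    then show ?thesis by (metis nle_le)
  qed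
  then have "accepting_path (strategy_automaton i) \<rho> p" for p
    using run accepting_path_buchi[OF buchi_strategy_automaton, of \<rho> i p] by (simp add: is_run_def)
  then have "accepting_run (strategy_automaton i) t \<rho>"
    using run by (simp add: accepting_run_def)
  then show ?thesis by blast
qed

lemma buchi_language_wins: "buchi_language {..<4} {t \<in> trees {..<4}. wins i t}"
proof -
  have "language (strategy_automaton i) = {t \<in> trees {..<4}. wins i t}"
    using wins_if_accepting_run accepting_run_if_wins
    by (auto simp: language_def)
  then show ?thesis
    unfolding buchi_language_def
    by (intro exI[of _ "strategy_automaton i"]) (simp add: buchi_strategy_automaton)
qed

section \<open>A game tree that plays two automata against each other\<close>

definition child :: "dir \<Rightarrow> 'q \<times> 'q \<Rightarrow> 'q" where
  "child d s = (case d of One \<Rightarrow> fst s | Two \<Rightarrow> snd s)"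

text \<open>
  The players alternate, player \<open>i\<close> making the moves at the times \<open>2 * m + i\<close>. A round consists of
  \<open>Suc k\<close> moves of each. With the first \<open>k\<close> moves of round \<open>r\<close>, player \<open>i\<close> spells out (\<open>code\<close>) the pair
  of successor states in the run of \<open>A i\<close>; the last move is the next direction (\<open>turn\<close>) in the run of
  the other automaton. That automaton's transition is therefore known before its direction is
  chosen, and only past directions are known when the transition is chosen, as in a run on a tree.

  A player who spells out an impossible transition ceases to be \<open>legal\<close> and never scores a \<open>hit\<close>
  again. If both players score in the same round, \<open>latch\<close> keeps its value: what matters is that it
  ends up constant when exactly one of them scores infinitely often.
\<close>

locale duel =
  fixes A :: "nat \<Rightarrow> ('a, 'q) automaton" and k :: nat and dec :: "dir list \<Rightarrow> 'q \<times> 'q"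
begin

definition code :: "(nat \<Rightarrow> dir) \<Rightarrow> nat \<Rightarrow> nat \<Rightarrow> dir list" where
  "code p i r = map (\<lambda>j. p (2 * (r * Suc k + j) + i)) [0..<k]"

definition turn :: "(nat \<Rightarrow> dir) \<Rightarrow> nat \<Rightarrow> nat \<Rightarrow> dir" where
  "turn p i r = p (2 * (r * Suc k + k) + (1 - i))"

definition state :: "(nat \<Rightarrow> dir) \<Rightarrow> nat \<Rightarrow> nat \<Rightarrow> 'q" where
  "state p i r = (case r of 0 \<Rightarrow> init (A i) | Suc s \<Rightarrow> child (turn p i s) (dec (code p i s)))"

definition legal :: "'a tree \<Rightarrow> (nat \<Rightarrow> dir) \<Rightarrow> nat \<Rightarrow> nat \<Rightarrow> bool" where
  "legal t p i r \<longleftrightarrow> (\<forall>s<r. (state p i s, t (pre (turn p i) s), dec (code p i s)) \<in> trans (A i))"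

definition hit :: "'a tree \<Rightarrow> (nat \<Rightarrow> dir) \<Rightarrow> nat \<Rightarrow> nat \<Rightarrow> bool" where
  "hit t p i r \<longleftrightarrow> legal t p i r \<and> rank (A i) (state p i r) = 2"

fun latch :: "'a tree \<Rightarrow> (nat \<Rightarrow> dir) \<Rightarrow> nat \<Rightarrow> nat" where
  "latch t p 0 = 0"
| "latch t p (Suc r) = (if hit t p 0 r \<and> \<not> hit t p 1 r then 0
     else if hit t p 1 r \<and> \<not> hit t p 0 r then 1 else latch t p r)"

definition game_tree :: "'a tree \<Rightarrow> nat tree" where
  "game_tree t w = length w mod 2 + 2 * latch t (extend_path w) (length w div (2 * Suc k))"

lemma latch_le_1: "latch t p r \<le> 1"
  by (induction r) auto

lemma game_tree_in_trees: "game_tree t \<in> trees {..<4}"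
proof -
  have "game_tree t w < 4" for w
    using latch_le_1[of t "extend_path w" "length w div (2 * Suc k)"] mod_less_divisor[of 2 "length w"]
    unfolding game_tree_def by linarith
  then show ?thesis by (auto simp: trees_def)
qed

lemma round_end_le: "s < r \<Longrightarrow> j \<le> k \<Longrightarrow> i \<le> 1 \<Longrightarrow> 2 * (s * Suc k + j) + i < 2 * Suc k * r"
proof -
  assume "s < r" "j \<le> k" "i \<le> 1"
  from \<open>s < r\<close> have "Suc s * Suc k \<le> r * Suc k" by (intro mult_le_mono1) simp
  then show ?thesis using \<open>j \<le> k\<close> \<open>i \<le> 1\<close> by (simp add: algebra_simps)
qed

lemma turn_cong:
  assumes "\<And>n. n < 2 * Suc k * r \<Longrightarrow> p n = q n" "s < r"
  shows "turn p i s = turn q i s"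
  unfolding turn_def by (intro assms(1) round_end_le[OF assms(2)]) auto

lemma code_cong:
  assumes "\<And>n. n < 2 * Suc k * r \<Longrightarrow> p n = q n" "s < r" "i \<le> 1"
  shows "code p i s = code q i s"
  unfolding code_def by (intro map_cong refl assms(1) round_end_le[OF assms(2)]) (use assms(3) in auto)

lemma pre_turn_cong:
  assumes "\<And>n. n < 2 * Suc k * r \<Longrightarrow> p n = q n" "s \<le> r"
  shows "pre (turn p i) s = pre (turn q i) s"
  by (rule pre_cong) (use assms turn_cong[of r p q] in auto)

lemma state_cong:
  assumes "\<And>n. n < 2 * Suc k * r \<Longrightarrow> p n = q n" "s \<le> r" "i \<le> 1"
  shows "state p i s = state q i s"
  using turn_cong[of r p q] code_cong[of r p q] assms by (auto simp: state_def split: nat.split)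

lemma latch_cong:
  assumes "\<And>n. n < 2 * Suc k * r \<Longrightarrow> p n = q n" "\<And>u. length u < r \<Longrightarrow> t u = t' u" "s \<le> r"
  shows "latch t p s = latch t' q s"
  using assms(3)
proof (induction s)
  case (Suc s)
  have "hit t p i s = hit t' q i s" if "i \<le> 1" for i
    using state_cong[of r p q] pre_turn_cong[of r p q] code_cong[of r p q] assms(1,2) Suc.prems that
    by (simp add: hit_def legal_def)
  with Suc show ?case by simp
qed simp

text \<open>The construction is contracting, since a round takes at least two moves and advances by one level of \<open>t\<close>.\<close>

lemma game_tree_cong:
  assumes "\<And>u. length u < length w \<Longrightarrow> t u = t' u"
  shows "game_tree t w = game_tree t' w"
proof -
  have "length w div (2 * Suc k) \<le> length w" by (rule div_le_dividend)
  then have "latch t (extend_path w) (length w div (2 * Suc k)) = latch t' (extend_path w) (length w div (2 * Suc k))"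
    by (intro latch_cong[OF refl _ order_refl] assms) (rule less_le_trans)
  then show ?thesis by (simp add: game_tree_def)
qed

lemma game_tree_pre: "game_tree t (pre p n) = n mod 2 + 2 * latch t p (n div (2 * Suc k))"
proof -
  have "2 * Suc k * (n div (2 * Suc k)) \<le> n" by (rule times_div_less_eq_dividend)
  then have "latch t (extend_path (pre p n)) (n div (2 * Suc k)) = latch t p (n div (2 * Suc k))"
    by (intro latch_cong[OF _ refl order_refl]) (simp add: extend_path_pre)
  then show ?thesis by (simp add: game_tree_def)
qed

lemma latch_stays:
  assumes "{x, y} = {0, 1}" "hit t p x r" "\<And>s. s \<ge> r \<Longrightarrow> \<not> hit t p y s" "s > r"
  shows "latch t p s = x"
  using assms(4)
proof (induction s)
  case (Suc s)
  have xy: "x = 0 \<and> y = 1 \<or> x = 1 \<and> y = 0"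
    using assms(1) by (auto simp: doubleton_eq_iff)
  show ?case
  proof (cases "s = r")
    case True
    then show ?thesis using assms(2) assms(3)[of r] xy by auto
  next
    case False
    then show ?thesis using Suc assms(3)[of s] xy by auto
  qed
qed simp

text \<open>If \<open>y\<close> stopped scoring, the next hit of \<open>x\<close> would fix the colour at \<open>x\<close> for good.\<close>

lemma hit_infinitely_often:
  assumes xy: "{x, y} = {0, 1}" and x: "infinitely_often (hit t p x)"
    and y: "infinitely_often (\<lambda>n. game_tree t (pre p n) div 2 = y)"
  shows "infinitely_often (hit t p y)"
proof (rule ccontr)
  assume "\<not> ?thesis"
  then obtain R where R: "\<And>s. s \<ge> R \<Longrightarrow> \<not> hit t p y s" by blast
  obtain r where r: "r \<ge> R" "hit t p x r" using x by blast
  obtain n where n: "n \<ge> Suc r * (2 * Suc k)" "game_tree t (pre p n) div 2 = y" using y by blast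
  have "n div (2 * Suc k) \<ge> Suc r"
    using n(1) by (metis div_le_mono nonzero_mult_div_cancel_right nat.simps(3) mult_eq_0_iff numeral_2_eq_2)
  then have "latch t p (n div (2 * Suc k)) = x"
    using R r by (intro latch_stays[OF xy r(2)]) auto
  moreover have "latch t p (n div (2 * Suc k)) = y"
    using n(2) by (simp add: game_tree_pre)
  ultimately show False using xy by auto
qed

text \<open>
  Player \<open>x\<close> follows the accepting run \<open>\<rho>\<close> and plays an arbitrary sequence \<open>d\<close> of directions against
  \<open>A y\<close>, while player \<open>y\<close> uses the winning strategy. In each of the resulting plays \<open>P d\<close> player \<open>x\<close>
  scores infinitely often, hence so does player \<open>y\<close>, who then has always played legally. The state
  that \<open>A y\<close> has reached after \<open>r\<close> rounds depends only on the first \<open>r\<close> directions, so the states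
  collected from all the plays label the nodes of a tree. This tree is an accepting run of \<open>A y\<close>.
\<close>

lemma accepting_run_if_wins_duel:
  assumes xy: "{x, y} = {0, 1}"
    and buchi: "buchi_automaton (A x)" "buchi_automaton (A y)"
    and acc: "accepting_run (A x) t \<rho>"
    and enc: "\<And>s. s \<in> states (A x) \<times> states (A x) \<Longrightarrow> length (enc s) = k \<and> dec (enc s) = s"
    and wins: "wins y (game_tree t)"
  shows "\<exists>\<rho>'. accepting_run (A y) t \<rho>'"
proof -
  have xy': "x = 0 \<and> y = 1 \<or> x = 1 \<and> y = 0" using xy by (auto simp: doubleton_eq_iff)
  then have le1: "x \<le> 1" "y \<le> 1" by auto
  have run: "is_run (A x) t \<rho>" using acc by (simp add: accepting_run_def)
  have game_mod: "game_tree t (pre p n) mod 2 = n mod 2" for p n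
    by (simp add: game_tree_pre)
  obtain \<sigma> where \<sigma>: "\<And>p. (\<forall>n. n mod 2 = y \<longrightarrow> p n = \<sigma> (pre p n)) \<Longrightarrow>
      infinitely_often (\<lambda>n. game_tree t (pre p n) div 2 = y)"
    using wins unfolding wins_def forces_def by (auto simp: game_mod)
  define move where "move d w = (let n = length w; r = n div 2 div Suc k; j = n div 2 mod Suc k;
      u = pre (turn (extend_path w) x) r in
      if n mod 2 = y then \<sigma> w else if j < k then enc (\<rho> (u @ [One]), \<rho> (u @ [Two])) ! j else d r)" for d w
  have "\<forall>d. \<exists>p. \<forall>n. p n = move d (pre p n)" using ex_play_following by blast
  then obtain P where P: "\<And>d n. P d n = move d (pre (P d) n)" by metis
  \<comment> \<open>the branch of \<open>A y\<close> is \<open>d\<close>, and the run of \<open>A x\<close> is \<open>\<rho>\<close> restricted to the branch chosen by \<open>y\<close>\<close>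
  have turn_y: "turn (P d) y = d" for d
  proof
    fix r
    let ?n = "2 * (r * Suc k + k) + x"
    have "?n mod 2 \<noteq> y" "?n div 2 = r * Suc k + k" using xy' by auto
    moreover have "(r * Suc k + k) div Suc k = r" "(r * Suc k + k) mod Suc k = k" 
      by (simp_all only: div_mult_self3 mod_mult_self3) simp_all
    ultimately have "P d ?n = d r"
      unfolding P[of d ?n] move_def by (simp add: Let_def del: mult_Suc_right)
    moreover have "1 - y = x" using xy' by auto
    ultimately show "turn (P d) y r = d r" by (simp add: turn_def)
  qed
  have code_x: "code (P d) x r = enc (\<rho> (pre (turn (P d) x) r @ [One]), \<rho> (pre (turn (P d) x) r @ [Two]))"
    (is "_ = enc ?s") for d r
  proof (rule nth_equalityI)
    have "?s \<in> states (A x) \<times> states (A x)" using run by (auto simp: is_run_def)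
    then show "length (code (P d) x r) = length (enc ?s)" using enc by (simp add: code_def)
    fix j assume "j < length (code (P d) x r)"
    then have j: "j < k" by (simp add: code_def)
    let ?n = "2 * (r * Suc k + j) + x"
    have "?n mod 2 \<noteq> y" "?n div 2 = r * Suc k + j" using xy' by auto
    moreover have "(r * Suc k + j) div Suc k = r" "(r * Suc k + j) mod Suc k = j"
      using j by (simp_all only: div_mult_self3 mod_mult_self3) simp_all
    moreover have "pre (turn (extend_path (pre (P d) ?n)) x) r = pre (turn (P d) x) r"
      by (rule pre_turn_cong[OF _ order_refl]) (simp add: extend_path_pre algebra_simps)
    ultimately have "P d ?n = enc ?s ! j"
      unfolding P[of d ?n] move_def using j by (simp add: Let_def del: mult_Suc_right)
    then show "code (P d) x r ! j = enc ?s ! j" using j by (simp add: code_def)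
  qed
  have dec_x: "dec (code (P d) x r) = (\<rho> (pre (turn (P d) x) r @ [One]), \<rho> (pre (turn (P d) x) r @ [Two]))" for d r
    unfolding code_x using run by (intro conjunct2[OF enc]) (auto simp: is_run_def)
  have state_x: "state (P d) x r = \<rho> (pre (turn (P d) x) r)" for d r
    using run by (cases r) (auto simp: state_def dec_x child_def pre_Suc is_run_def split: dir.split)
  have "legal t (P d) x r" for d r
    using run by (simp add: legal_def state_x dec_x is_run_def)
  moreover have "infinitely_often (\<lambda>r. rank (A x) (state (P d) x r) = 2)" for d
    using acc accepting_path_buchi[OF buchi(1), of \<rho> "turn (P d) x"]
    by (simp add: state_x accepting_run_def is_run_def)
  ultimately have hit_x: "infinitely_often (hit t (P d) x)" for d
    by (simp add: hit_def)
  have hit_y: "infinitely_often (hit t (P d) y)" for d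
  proof (rule hit_infinitely_often[OF xy hit_x])
    show "infinitely_often (\<lambda>n. game_tree t (pre (P d) n) div 2 = y)"
    proof (rule \<sigma>, intro allI impI)
      fix n assume "n mod 2 = y"
      then show "P d n = \<sigma> (pre (P d) n)" unfolding P[of d n] by (simp add: move_def)
    qed
  qed
  have legal_y: "legal t (P d) y r" for d r
  proof -
    obtain s where "s \<ge> r" "hit t (P d) y s" using hit_y by blast
    then show ?thesis by (auto simp: hit_def legal_def)
  qed
  \<comment> \<open>direction \<open>d r\<close> is played only after both players have spelled out their transitions of round \<open>r\<close>\<close>
  have P_cong: "P d n = P d' n" if "\<And>s. s < r \<Longrightarrow> d s = d' s" "n < 2 * (r * Suc k + k)" for d d' r n
    using that(2)
  proof (induction n rule: less_induct)
    case (less n)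
    have pre_eq: "pre (P d) n = pre (P d') n"
      using less by (intro pre_cong) auto
    have "d (n div 2 div Suc k) = d' (n div 2 div Suc k)" if "\<not> n div 2 mod Suc k < k"
    proof -
      have "n div 2 mod Suc k = k" using that mod_less_divisor[of "Suc k" "n div 2"] by linarith
      then have "n div 2 div Suc k * Suc k + k = n div 2"
        by (metis div_mult_mod_eq)
      also have "n div 2 < r * Suc k + k" using less.prems by (intro less_mult_imp_div_less) (simp only: mult.commute)
      finally have "n div 2 div Suc k * Suc k < r * Suc k" by (rule add_less_imp_less_right)
      then show ?thesis by (intro \<open>\<And>s. s < r \<Longrightarrow> d s = d' s\<close>) (meson mult_less_cancel2)
    qed
    then show ?case
      unfolding P[of d n] P[of d' n] pre_eq by (simp add: move_def Let_def)
  qed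
  have code_y_cong: "code (P d) y r = code (P d') y r" if "\<And>s. s < r \<Longrightarrow> d s = d' s" for d d' r
    unfolding code_def by (intro map_cong refl P_cong[OF that]) (use le1 in auto)
  have state_y_cong: "state (P d) y r = state (P d') y r" if "\<And>s. s < r \<Longrightarrow> d s = d' s" for d d' r
    using that code_y_cong[of _ d d'] by (auto simp: state_def turn_y split: nat.split)
  define \<rho>' where "\<rho>' u = state (P (extend_path u)) y (length u)" for u
  have state_y: "state (P d) y r = \<rho>' (pre d r)" for d r
    unfolding \<rho>'_def length_pre by (rule state_y_cong) (simp add: extend_path_pre)
  have child_y: "\<rho>' (u @ [d]) = child d (dec (code (P (extend_path u)) y (length u)))" for u d
  proof -
    have "code (P (extend_path (u @ [d]))) y (length u) = code (P (extend_path u)) y (length u)"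
      by (rule code_y_cong) (simp add: extend_path_def nth_append)
    then show ?thesis by (simp add: \<rho>'_def state_def turn_y extend_path_def)
  qed
  have trans: "(\<rho>' u, t u, \<rho>' (u @ [One]), \<rho>' (u @ [Two])) \<in> trans (A y)" for u
    using legal_y[of "extend_path u" "Suc (length u)"]
    by (auto simp: legal_def turn_y child_y child_def \<rho>'_def[of u])
  have run': "is_run (A y) t \<rho>'"
  proof -
    have "\<rho>' u \<in> states (A y)" for u
      using trans[of u] buchi(2) by (auto simp: buchi_automaton_def parity_automaton_def)
    then show ?thesis using trans by (auto simp: is_run_def \<rho>'_def state_def)
  qed
  have "infinitely_often (\<lambda>n. rank (A y) (\<rho>' (pre d n)) = 2)" for d
    using hit_y[of d] unfolding hit_def state_y by blast
  then have "accepting_path (A y) \<rho>' d" for d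
    using run' accepting_path_buchi[OF buchi(2), of \<rho>' d] by (simp add: is_run_def)
  then have "accepting_run (A y) t \<rho>'"
    using run' by (simp add: accepting_run_def)
  then show ?thesis by blast
qed

end

section \<open>Inseparability\<close>

lemma ex_game_tree_fixpoint:
  fixes A :: "nat \<Rightarrow> (nat, 'q) automaton"
  shows "\<exists>t. duel.game_tree A k dec t = t"
proof -
  let ?F = "duel.game_tree A k dec"
  have "adm_wf (measure length) ?F"
    unfolding adm_wf_def by (auto intro!: duel.game_tree_cong)
  from wfrec_fixpoint[OF wf_measure this] show ?thesis by metis
qed

text \<open>The code of an element of \<open>S\<close> marks with \<open>One\<close> where it occurs in an enumeration of \<open>S\<close>.\<close>

lemma ex_dir_encoding:
  assumes "finite S"
  shows "\<exists>k enc dec. \<forall>s\<in>S. length (enc s :: dir list) = k \<and> dec (enc s) = s"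
proof -
  obtain xs where xs: "set xs = S" using finite_list[OF assms] by blast
  define enc where "enc s = map (\<lambda>x. if x = s then One else Two) xs" for s
  have "inj_on enc S"
    unfolding inj_on_def enc_def xs[symmetric] by (auto split: if_splits)
  then have "\<forall>s\<in>S. inv_into S enc (enc s) = s" by simp
  moreover have "length (enc s) = length xs" for s by (simp add: enc_def)
  ultimately have "\<forall>s\<in>S. length (enc s) = length xs \<and> inv_into S enc (enc s) = s" by simp
  then show ?thesis by blast
qed

text \<open>The diagonal argument: the fixed point of the game tree construction is in neither language.\<close>

lemma separating_buchi_languages_not_complementary:
  fixes A :: "nat \<Rightarrow> (nat, 'q) automaton"
  assumes buchi: "\<And>i. i \<le> 1 \<Longrightarrow> buchi_automaton (A i)"
    and sep: "language (A 0) \<subseteq> {t. wins 1 t}" "language (A 1) \<subseteq> {t. wins 0 t}"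
    and disj: "language (A 0) \<inter> language (A 1) = {}"
    and alph: "\<And>i. i \<le> 1 \<Longrightarrow> alphabet (A i) = {..<4}"
  shows "language (A 0) \<union> language (A 1) \<noteq> trees {..<4}"
proof
  assume cover: "language (A 0) \<union> language (A 1) = trees {..<4}"
  let ?S = "\<Union>i\<in>{0, 1}. states (A i) \<times> states (A i)"
  have "finite ?S"
    using buchi[of 0] buchi[of 1] by (auto simp: buchi_automaton_def parity_automaton_def)
  from ex_dir_encoding[OF this] obtain k enc dec where
    enc: "\<forall>s\<in>?S. length (enc s :: dir list) = k \<and> dec (enc s) = s" by blast
  obtain t where t: "duel.game_tree A k dec t = t" using ex_game_tree_fixpoint by blast
  have "t \<in> trees {..<4}" using duel.game_tree_in_trees[of A k dec t] t by simp
  have contra: False if xy: "{x, y} = {0, 1}" and x: "t \<in> language (A x)" and y: "wins y t" for x y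
  proof -
    have le1: "x \<in> {0, 1}" "y \<in> {0, 1}" using xy by blast+
    obtain \<rho> where "accepting_run (A x) t \<rho>" using x by (auto simp: language_def)
    then have "\<exists>\<rho>'. accepting_run (A y) t \<rho>'"
    proof (intro duel.accepting_run_if_wins_duel[where A = A and k = k and dec = dec, OF xy])
      show "buchi_automaton (A x)" "buchi_automaton (A y)" using le1 by (auto intro!: buchi)
      show "length (enc s) = k \<and> dec (enc s) = s" if "s \<in> states (A x) \<times> states (A x)" for s
        using enc le1(1) that by blast
      show "wins y (duel.game_tree A k dec t)" using y t by simp
    qed
    moreover have "y \<le> 1" using le1 by auto
    then have "alphabet (A y) = {..<4}" by (rule alph)
    ultimately have "t \<in> language (A y)"
      using \<open>t \<in> trees {..<4}\<close> by (simp add: language_def)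
    moreover consider "x = 0" "y = 1" | "x = 1" "y = 0"
      using xy by (auto simp: doubleton_eq_iff)
    ultimately show False
      by cases (use x disj in blast)+
  qed
  have "t \<in> language (A 0) \<or> t \<in> language (A 1)" using cover \<open>t \<in> trees {..<4}\<close> by blast
  then show False using contra[of 0 1] contra[of 1 0] sep by auto
qed

theorem corollary2p3:
  "\<exists>\<Sigma> :: nat set. finite \<Sigma> \<and>
     \<not> first_separation_property (trees \<Sigma>) {L. co_buchi_language \<Sigma> L}"
proof (intro exI conjI)
  let ?U = "trees {..<4 :: nat}"
  let ?W = "\<lambda>i. {t \<in> ?U. wins i t}"
  show "finite {..<4 :: nat}" by simp
  show "\<not> first_separation_property ?U {L. co_buchi_language {..<4} L}"
  proof
    assume sep: "first_separation_property ?U {L. co_buchi_language {..<4} L}"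
    have "co_buchi_language {..<4} (?U - ?W i)" for i
      unfolding co_buchi_language_def using buchi_language_wins by blast
    moreover have "(?U - ?W 0) \<inter> (?U - ?W 1) = {}"
      using someone_wins by auto
    ultimately have "\<exists>K. ?U - ?W 0 \<subseteq> K \<and> K \<subseteq> ?U - (?U - ?W 1) \<and>
        K \<in> {L. co_buchi_language {..<4} L} \<and> ?U - K \<in> {L. co_buchi_language {..<4} L}"
      by (intro sep[unfolded first_separation_property_def, rule_format]) simp_all
    then obtain K where K: "?U - ?W 0 \<subseteq> K" "K \<subseteq> ?U - (?U - ?W 1)"
        "co_buchi_language {..<4} K" "co_buchi_language {..<4} (?U - K)"
      by blast
    obtain A0 A1 :: "(nat, nat) automaton" where
      A: "buchi_automaton A0" "alphabet A0 = {..<4}" "?U - K = ?U - language A0"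
         "buchi_automaton A1" "alphabet A1 = {..<4}" "K = ?U - language A1"
      using K(3,4) unfolding co_buchi_language_def buchi_language_def by blast
    have "language A0 \<subseteq> ?U" "language A1 \<subseteq> ?U" using A by (auto simp: language_def)
    then have lang: "language A0 = K" "language A1 = ?U - K" using A K by auto
    have "language A0 \<subseteq> {t. wins 1 t}" "language A1 \<subseteq> {t. wins 0 t}"
      unfolding lang using K(1,2) by blast+
    then have "language A0 \<union> language A1 \<noteq> ?U"
      using separating_buchi_languages_not_complementary[of "\<lambda>i. if i = 0 then A0 else A1"] A(1,2,4,5) lang by simp
    then show False using lang \<open>language A0 \<subseteq> ?U\<close> by blast
  qed
qed

end
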